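(* Let $\mathcal{P}$ be an inhomogeneous Poisson point process on $\Omega=[0,w]\times[0,h]\times[0,T]$ with nonnegative, bounded, measurable flux function $\phi(x,y,t)$. Let $p(x,y,t)$ be a bounded, deterministic, measurable probing function on $\Omega$. Then $$\sum_{(x_i,y_i,t_i)\in\mathcal{P}} p(x_i,y_i,t_i)=\int_0^{T}\int_0^{h}\int_0^{w} p(x,y,t)\,\phi(x,y,t)\,dx\,dy\,dt+M_p(T),$$ where $M_p(T)$ is the value at time $T$ of the process $$M_p(t)=\int_{A\times[0,t]}p(\mathbf{x})\,dM(\mathbf{x}),\qquad t\in[0,T],$$ and $(M_p(t))_{t\in[0,T]}$ is a martingale with respect to the filtration $\{\mathcal{F}_t\}_{t\in[0,T]}$ of the process. If instead $\mathcal{P}$ is a one-dimensional inhomogeneous Poisson process on $[0,T]$ with flux $\phi(t)$ and $p(t)$ is a bounded, deterministic, measurable function on $[0,T]$, the decomposition reads $\sum_{t_i\in\mathcal{P}}p(t_i)=\int_0^{T}p(t)\phi(t)\,dt+M_p(T)$.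
   Context: $A=[0,w]\times[0,h]$ is the sensor area (with $w,h>0$ finite), $T>0$ is the finite exposure time, and $\Omega=A\times[0,T]$. An inhomogeneous Poisson point process $\mathcal{P}$ on $\Omega$ with flux function $\phi$ is a point process such that $\mathcal{P}(B)\sim\mathrm{Poisson}\big(\int_B\phi(\mathbf{x})\,d\mathbf{x}\big)$ for every measurable $B\subseteq\Omega$, where $\mathcal{P}(B)$ is the number of points in $B$, and such that counts over disjoint measurable sets are independent. Fluxes are always assumed nonnegative, bounded and measurable. The filtration $\mathcal{F}_t$ encodes all information observed up to time $t$ over the full sensor, i.e. $\mathcal{F}_t$ is generated by the restriction of $\mathcal{P}$ to $A\times[0,t]$. $M$ denotes the compensated (signed, random) measure $dM(\mathbf{x})=d\mathcal{P}(\mathbf{x})-\phi(\mathbf{x})\,d\mathbf{x}$, so integrals against $M$ are differences of the integral against the counting measure $\mathcal{P}$ and the integral against $\phi(\mathbf{x})\,d\mathbf{x}$. In the one-dimensional case the same definitions are used with $A$ omitted. A process $M(t)$ is an $\mathcal{F}$-martingale if it is adapted, $\mathbb{E}|M(t)|<\infty$ for all $t\in[0,T]$, and $\mathbb{E}[M(t)\mid\mathcal{F}_s]=M(s)$ a.s. for all $s\le t$. *)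

theory Defs
  imports "HOL-Probability.Probability"
begin

text \<open>
  A configuration of points is a finite multiset: the regions considered are bounded and the
  fluxes are bounded, so a locally finite configuration has finitely many points.  Multiplicities
  are admitted so that simplicity of the process is not an extra assumption.
\<close>

definition restrict_points :: "'a set \<Rightarrow> 'a multiset \<Rightarrow> 'a multiset" where
  "restrict_points B X = filter_mset (\<lambda>x. x \<in> B) X"

definition count_points :: "'a set \<Rightarrow> 'a multiset \<Rightarrow> nat" where
  "count_points B X = size (restrict_points B X)"

definition config_space :: "'a::topological_space multiset measure" where
  "config_space = sigma UNIV {{X. count_points B X = k} | B k. B \<in> sets borel}"

text \<open>
  The constant \<^const>\<open>poisson_pmf\<close> is only specified for positive rates; rate zero is the
  point mass at zero (needed e.g. for Lebesgue null sets).
\<close>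

definition poisson_law :: "real \<Rightarrow> nat pmf" where
  "poisson_law r = (if 0 < r then poisson_pmf r else return_pmf 0)"

locale inhomogeneous_poisson_process = prob_space M
  for M :: "'w measure"
    and \<Omega> :: "'a::euclidean_space set"
    and \<phi> :: "'a \<Rightarrow> real"
    and P :: "'w \<Rightarrow> 'a multiset" +
  assumes flux_measurable: "\<phi> \<in> borel_measurable (restrict_space borel \<Omega>)"
    and flux_nonneg: "\<And>x. x \<in> \<Omega> \<Longrightarrow> 0 \<le> \<phi> x"
    and flux_bounded: "bounded (\<phi> ` \<Omega>)"
    and random_configuration: "P \<in> measurable M config_space"
    and points_in_region: "\<And>\<omega>. \<omega> \<in> space M \<Longrightarrow> set_mset (P \<omega>) \<subseteq> \<Omega>"
    and poisson_counts: "\<And>B. B \<in> sets borel \<Longrightarrow> B \<subseteq> \<Omega> \<Longrightarrow>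
          distr M (count_space UNIV) (\<lambda>\<omega>. count_points B (P \<omega>)) =
          measure_pmf (poisson_law (LINT x:B|lborel. \<phi> x))"
    and independent_counts: "\<And>(B :: nat \<Rightarrow> 'a set) I.
          (\<And>i. i \<in> I \<Longrightarrow> B i \<in> sets borel \<and> B i \<subseteq> \<Omega>) \<Longrightarrow> disjoint_family_on B I \<Longrightarrow>
          indep_vars (\<lambda>_. count_space UNIV) (\<lambda>i \<omega>. count_points (B i) (P \<omega>)) I"

text \<open>The sigma-algebra generated by the restriction of the process to a region:\<close>

definition points_sigma ::
  "'w measure \<Rightarrow> ('w \<Rightarrow> 'a::topological_space multiset) \<Rightarrow> 'a set \<Rightarrow> 'w measure" where
  "points_sigma M P R = vimage_algebra (space M) (\<lambda>\<omega>. restrict_points R (P \<omega>)) config_space"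

text \<open>
  The integral of \<open>p\<close> over \<open>R\<close> against the compensated measure
  \<open>dP(x) - \<phi>(x) dx\<close>, as a function of the outcome:
\<close>

definition compensated_integral ::
  "('a::euclidean_space \<Rightarrow> real) \<Rightarrow> ('w \<Rightarrow> 'a multiset) \<Rightarrow> ('a \<Rightarrow> real) \<Rightarrow> 'a set \<Rightarrow> 'w \<Rightarrow> real" where
  "compensated_integral \<phi> P p R \<omega> =
     (\<Sum>x\<in>#restrict_points R (P \<omega>). p x) - (LINT x:R|lborel. p x * \<phi> x)"

definition is_martingale ::
  "'w measure \<Rightarrow> ('t::linorder \<Rightarrow> 'w measure) \<Rightarrow> 't set \<Rightarrow> ('t \<Rightarrow> 'w \<Rightarrow> real) \<Rightarrow> bool" where
  "is_martingale M F I X \<longleftrightarrow>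
     (\<forall>t\<in>I. subalgebra M (F t)) \<and>
     (\<forall>s\<in>I. \<forall>t\<in>I. s \<le> t \<longrightarrow> sets (F s) \<subseteq> sets (F t)) \<and>
     (\<forall>t\<in>I. X t \<in> borel_measurable (F t)) \<and>
     (\<forall>t\<in>I. integrable M (X t)) \<and>
     (\<forall>s\<in>I. \<forall>t\<in>I. s \<le> t \<longrightarrow> (AE \<omega> in M. real_cond_exp M (F s) (X t) \<omega> = X s \<omega>))"

text \<open>The space-time region \<open>A \<times> [0,t]\<close> over the sensor \<open>A = [0,w] \<times> [0,h]\<close>:\<close>

definition sensor_region :: "real \<Rightarrow> real \<Rightarrow> real \<Rightarrow> (real \<times> real \<times> real) set" where
  "sensor_region w h t = {0..w} \<times> {0..h} \<times> {0..t}"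

end

theory Submission
  imports Defs
begin

text \<open>
  The increment of \<open>M\<^sub>p\<close> between \<open>s\<close> and \<open>t\<close> is the compensated integral over the
  set \<open>D\<close> of points with time in \<open>(s, t]\<close>, which is disjoint from the region observed up to
  time \<open>s\<close>.  For an event \<open>A\<close> of the past and a Borel set \<open>B \<subseteq> D\<close>, the count in \<open>B\<close> is
  independent of \<open>A\<close>, so its expectation over \<open>A\<close> is the probability of \<open>A\<close> times the flux
  through \<open>B\<close>.  Linearity extends this Campbell formula to simple functions, and dominated
  convergence to all bounded \<open>p\<close>; hence the increment integrates to zero over every past event.
\<close>

section \<open>Configurations of points\<close>

lemma count_points_restrict [simp]:
  "count_points B (restrict_points R X) = count_points (B \<inter> R) X"
  by (simp add: count_points_def restrict_points_def filter_filter_mset conj_commute)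

lemma restrict_points_restrict:
  "restrict_points R (restrict_points S X) = restrict_points (R \<inter> S) X"
  by (simp add: restrict_points_def filter_filter_mset conj_commute)

lemma restrict_points_Un:
  assumes "A \<inter> B = {}"
  shows "restrict_points (A \<union> B) X = restrict_points A X + restrict_points B X"
  using assms by (induction X) (auto simp: restrict_points_def)

lemma count_points_empty_mset [simp]: "count_points B {#} = 0"
  by (simp add: count_points_def restrict_points_def)

lemma count_points_add_mset [simp]:
  "count_points B (add_mset x X) = (if x \<in> B then 1 else 0) + count_points B X"
  by (simp add: count_points_def restrict_points_def)

text \<open>Induction on the configuration: a point of the union lies in exactly one of the disjoint
  sets, so it adds one to both sides. This later recovers the count over a set from the counts over
  its atoms.\<close>

lemma count_points_UN:
  assumes "finite I" "disjoint_family_on A I"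
  shows "count_points (\<Union>i\<in>I. A i) X = (\<Sum>i\<in>I. count_points (A i) X)"
proof (induction X)
  case (add x X)
  have "(if x \<in> (\<Union>i\<in>I. A i) then 1 else 0) = (\<Sum>i\<in>I. if x \<in> A i then 1 else (0::nat))"
  proof (cases "x \<in> (\<Union>i\<in>I. A i)")
    case True
    then obtain j where j: "j \<in> I" "x \<in> A j" by auto
    then have "x \<in> A i \<longleftrightarrow> i = j" if "i \<in> I" for i
      using assms(2) that by (auto simp: disjoint_family_on_def)
    then have "(\<Sum>i\<in>I. if x \<in> A i then 1 else (0::nat)) = (\<Sum>i\<in>I. if i = j then 1 else 0)"
      by (intro sum.cong) auto
    with j assms(1) True show ?thesis by simp
  qed auto
  with add show ?case by (simp add: sum.distrib)
qed simp

section \<open>Measurability on the space of configurations\<close>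

lemma space_config_space [simp]: "space config_space = UNIV"
  by (simp add: config_space_def space_measure_of_conv)

text \<open>The level sets of the counts generate \<open>config_space\<close>, so measurability into
  it can be tested on the counts alone.\<close>

lemma measurable_config_spaceI:
  fixes g :: "'w \<Rightarrow> 'a::topological_space multiset"
  assumes "\<And>B. B \<in> sets borel \<Longrightarrow> (\<lambda>\<omega>. count_points B (g \<omega>)) \<in> measurable N (count_space UNIV)"
  shows "g \<in> measurable N config_space"
  unfolding config_space_def
proof (rule measurable_measure_of)
  fix Y :: "'a multiset set" assume "Y \<in> {{X. count_points B X = k} |B k. B \<in> sets borel}"
  then obtain B k where Y: "Y = {X. count_points B X = k}" "B \<in> sets borel" by auto
  have "g -` Y \<inter> space N = (\<lambda>\<omega>. count_points B (g \<omega>)) -` {k} \<inter> space N"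
    using Y by auto
  also have "\<dots> \<in> sets N" by (rule measurable_sets[OF assms[OF Y(2)]]) simp
  finally show "g -` Y \<inter> space N \<in> sets N" .
qed auto

lemma measurable_count_points [measurable (raw)]:
  assumes "B \<in> sets borel" "g \<in> measurable N config_space"
  shows "(\<lambda>\<omega>. count_points B (g \<omega>)) \<in> measurable N (count_space UNIV)"
proof -
  have "count_points B -` {k} \<inter> space config_space \<in> sets config_space" for k
    using assms(1) by (auto simp: config_space_def vimage_def space_measure_of_conv)
  then have "count_points B \<in> measurable config_space (count_space UNIV)"
    by (intro measurable_count_space_eq2_countable[THEN iffD2]) auto
  from measurable_compose[OF assms(2) this] show ?thesis .
qed

lemma measurable_restrict_points [measurable (raw)]:
  assumes "R \<in> sets borel" "g \<in> measurable N config_space"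
  shows "(\<lambda>\<omega>. restrict_points R (g \<omega>)) \<in> measurable N config_space"
  using assms by (intro measurable_config_spaceI) simp

text \<open>Grouping the points by the value of \<open>f\<close> turns the sum into a linear
  combination of counts, the quantities of which the axioms of the process speak.\<close>

lemma sum_mset_simple_function:
  fixes f :: "'a::topological_space \<Rightarrow> real"
  assumes "finite (range f)"
  shows "(\<Sum>x\<in>#X. f x) = (\<Sum>y\<in>range f. y * count_points (f -` {y}) X)"
proof (induction X)
  case (add x X)
  have "(\<Sum>y\<in>range f. y * real (if x \<in> f -` {y} then 1 else 0)) = (\<Sum>y\<in>range f. if f x = y then y else 0)"
    by (intro sum.cong) auto
  also have "\<dots> = f x" using assms by simp
  finally show ?case using add
    by (simp add: distrib_left sum.distrib del: vimage_singleton_eq)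
qed simp

text \<open>A configuration is finite, so pointwise convergence passes to the sum.\<close>

lemma tendsto_sum_mset:
  fixes F :: "'i \<Rightarrow> 'a \<Rightarrow> real"
  assumes "\<And>x. ((\<lambda>i. F i x) \<longlongrightarrow> f x) L"
  shows "((\<lambda>i. \<Sum>x\<in>#X. F i x) \<longlongrightarrow> (\<Sum>x\<in>#X. f x)) L"
  using assms by (induction X) (auto intro!: tendsto_add)

text \<open>The bound by \<open>2 * \<bar>f x\<bar>\<close> makes the approximations uniformly
  bounded when \<open>f\<close> is bounded, as dominated convergence requires below.\<close>

lemma borel_measurable_imp_simple_limit:
  fixes f :: "'a::topological_space \<Rightarrow> real"
  assumes "f \<in> borel_measurable borel"
  obtains F where "\<And>i. F i \<in> borel_measurable borel" "\<And>i. finite (range (F i))"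
    "\<And>x. (\<lambda>i::nat. F i x) \<longlonglongrightarrow> f x" "\<And>i x. \<bar>F i x\<bar> \<le> 2 * \<bar>f x\<bar>"
proof -
  \<comment> \<open>With base point 0 the distance bound of this theorem becomes a bound on absolute
    values.\<close>
  from borel_measurable_implies_sequence_metric[OF assms, of 0] obtain F where F:
    "\<And>i. simple_function borel (F i)" "\<And>x. (\<lambda>i::nat. F i x) \<longlonglongrightarrow> f x"
    "\<And>i x. \<bar>F i x\<bar> \<le> 2 * \<bar>f x\<bar>" by auto
  show thesis
  proof (rule that[of F])
    show "F i \<in> borel_measurable borel" for i
      by (rule borel_measurable_simple_function[OF F(1)])
    show "finite (range (F i))" for i
      using F(1)[of i] by (simp add: simple_function_def)
  qed (fact F)+
qed

text \<open>For finitely valued functions the sum is a finite combination of measurable counts; the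
  general case is a pointwise limit of these.\<close>

lemma borel_measurable_sum_mset [measurable (raw)]:
  fixes f :: "'a::topological_space \<Rightarrow> real"
  assumes f: "f \<in> borel_measurable borel" and g: "g \<in> measurable N config_space"
  shows "(\<lambda>\<omega>. \<Sum>x\<in>#g \<omega>. f x) \<in> borel_measurable N"
proof -
  obtain F where F: "\<And>i. F i \<in> borel_measurable borel" "\<And>i. finite (range (F i))"
    "\<And>x. (\<lambda>i::nat. F i x) \<longlonglongrightarrow> f x"
    using borel_measurable_imp_simple_limit[OF f] by metis
  show ?thesis
  proof (rule borel_measurable_LIMSEQ_real)
    show "(\<lambda>i. \<Sum>x\<in>#g \<omega>. F i x) \<longlonglongrightarrow> (\<Sum>x\<in>#g \<omega>. f x)" for \<omega>
      by (rule tendsto_sum_mset[OF F(3)])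
    fix i
    have [measurable]: "F i -` {y} \<in> sets borel" for y
      using measurable_sets[OF F(1), of "{y}" i] by simp
    note g [measurable]
    show "(\<lambda>\<omega>. \<Sum>x\<in>#g \<omega>. F i x) \<in> borel_measurable N"
      unfolding sum_mset_simple_function[OF F(2)] by measurable
  qed
qed

section \<open>The sigma-algebra generated by the points in a region\<close>

lemma space_points_sigma [simp]: "space (points_sigma M P R) = space M"
  by (simp add: points_sigma_def)

lemma measurable_points_sigma:
  "(\<lambda>\<omega>. restrict_points R (P \<omega>)) \<in> measurable (points_sigma M P R) config_space"
  unfolding points_sigma_def by (rule measurable_vimage_algebra1) simp

text \<open>Minimality of the generated sigma-algebra. It yields both that the past consists of
  events of \<open>M\<close> and that the filtration increases.\<close>

lemma sets_points_sigma_subset: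
  assumes "(\<lambda>\<omega>. restrict_points R (P \<omega>)) \<in> measurable N config_space" "space N = space M"
  shows "sets (points_sigma M P R) \<subseteq> sets N"
  unfolding points_sigma_def
  using assms by (auto simp: sets_vimage_algebra2 dest!: measurable_sets)

text \<open>Preimages of a generator generate the preimage sigma-algebra. The resulting family is in
  general not closed under intersection, so the independence proof first passes to finite
  intersections.\<close>

lemma sets_points_sigma:
  "sets (points_sigma M P R) =
     sigma_sets (space M) {{\<omega>\<in>space M. count_points (B \<inter> R) (P \<omega>) = k} | B k. B \<in> sets borel}"
proof -
  have "sets (points_sigma M P R) = sigma_sets (space M)
     {(\<lambda>\<omega>. restrict_points R (P \<omega>)) -` A \<inter> space M | A. A \<in> {{X. count_points B X = k} | B k. B \<in> sets borel}}"
    unfolding points_sigma_def config_space_def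
    by (subst vimage_algebra_sigma) (auto intro!: sets_measure_of)
  also have "{(\<lambda>\<omega>. restrict_points R (P \<omega>)) -` A \<inter> space M | A. A \<in> {{X. count_points B X = k} | B k. B \<in> sets borel}}
      = {{\<omega>\<in>space M. count_points (B \<inter> R) (P \<omega>) = k} | B k. B \<in> sets borel}" (is "?L = ?R")
  proof (intro set_eqI iffI)
    have eq: "(\<lambda>\<omega>. restrict_points R (P \<omega>)) -` {X. count_points B X = k} \<inter> space M
      = {\<omega>\<in>space M. count_points (B \<inter> R) (P \<omega>) = k}" for B k by auto
    {
      fix A assume "A \<in> ?L"
      then obtain B k where "B \<in> sets borel"
        "A = (\<lambda>\<omega>. restrict_points R (P \<omega>)) -` {X. count_points B X = k} \<inter> space M"
        by (elim CollectE exE conjE) simp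
      then show "A \<in> ?R" unfolding eq by (intro CollectI exI conjI)
    next
      fix A assume "A \<in> ?R"
      then obtain B k where "B \<in> sets borel"
        "A = (\<lambda>\<omega>. restrict_points R (P \<omega>)) -` {X. count_points B X = k} \<inter> space M"
        unfolding eq by (elim CollectE exE conjE)
      then show "A \<in> ?L" by (intro CollectI exI conjI) auto
    }
  qed
  finally show ?thesis .
qed

lemma Int_stable_vimage_sets: "Int_stable {f -` A \<inter> S | A. A \<in> sets N}"
proof (rule Int_stableI)
  fix a b assume "a \<in> {f -` A \<inter> S | A. A \<in> sets N}" "b \<in> {f -` A \<inter> S | A. A \<in> sets N}"
  then obtain A B where "a = f -` A \<inter> S" "b = f -` B \<inter> S" "A \<in> sets N" "B \<in> sets N" by auto
  then have "a \<inter> b = f -` (A \<inter> B) \<inter> S" "A \<inter> B \<in> sets N" by auto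
  then show "a \<inter> b \<in> {f -` A \<inter> S | A. A \<in> sets N}" by blast
qed

lemma abs_sum_mset_le:
  fixes f :: "'a \<Rightarrow> real"
  assumes "\<And>x. \<bar>f x\<bar> \<le> K"
  shows "\<bar>\<Sum>x\<in>#X. f x\<bar> \<le> K * size X"
proof (induction X)
  case (add x X)
  have "\<bar>f x + (\<Sum>x\<in>#X. f x)\<bar> \<le> \<bar>f x\<bar> + \<bar>\<Sum>x\<in>#X. f x\<bar>" by (rule abs_triangle_ineq)
  also have "\<dots> \<le> K + K * size X" using add assms[of x] by simp
  finally show ?case by (simp add: algebra_simps)
qed simp

section \<open>Integration\<close>

text \<open>The mean of the Poisson law. Rate zero is treated apart, being a point mass by
  definition of \<open>poisson_law\<close>.\<close>

lemma has_bochner_integral_poisson_law: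
  assumes "0 \<le> r"
  shows "has_bochner_integral (measure_pmf (poisson_law r)) real r"
proof (cases "r = 0")
  case True
  then show ?thesis
    by (auto simp: poisson_law_def has_bochner_integral_iff intro!: integrable_measure_pmf_finite)
next
  case False
  with assms have r: "0 < r" by simp
  \<comment> \<open>The exponential series scaled by \<open>r * exp (-r)\<close>: its term at
    \<open>n\<close> is \<open>Suc n\<close> times the Poisson mass at \<open>Suc n\<close>.\<close>
  have "(\<lambda>n. r * exp (-r) * (r ^ n /\<^sub>R fact n)) sums (r * exp (-r) * exp r)"
    by (intro sums_mult exp_converges)
  then have "(\<lambda>n. real (Suc n) * pmf (poisson_pmf r) (Suc n)) sums r"
    using r by (simp add: exp_minus field_simps del: of_nat_Suc)
  \<comment> \<open>Undoing the index shift adds the term at 0, which vanishes.\<close>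
  then have s: "(\<lambda>n. pmf (poisson_pmf r) n * real n) sums r"
    by (subst (asm) sums_Suc_iff) (simp add: mult.commute)
  have "(\<integral>\<^sup>+n. ennreal (real n) \<partial>poisson_pmf r) = (\<Sum>n. ennreal (pmf (poisson_pmf r) n * real n))"
    by (simp only: nn_integral_measure_pmf nn_integral_count_space_nat ennreal_mult' pmf_nonneg)
  also have "\<dots> = ennreal r"
    using s by (intro suminf_ennreal_eq) simp
  finally have "has_bochner_integral (poisson_pmf r) real r"
    using r by (intro has_bochner_integral_nn_integral) auto
  with r show ?thesis by (simp add: poisson_law_def)
qed

lemma set_integrable_bounded:
  fixes f :: "'a \<Rightarrow> real"
  assumes S: "S \<in> sets N" "emeasure N S < \<infinity>"
    and f: "f \<in> borel_measurable (restrict_space N S)" "bounded (f ` S)"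
  shows "set_integrable N S f"
proof -
  obtain B where B: "\<And>x. x \<in> S \<Longrightarrow> \<bar>f x\<bar> \<le> B"
    using f(2) unfolding bounded_iff by auto
  have "S \<inter> space N = S" using sets.sets_into_space[OF S(1)] by auto
  with f(1) S(1) have m: "(\<lambda>x. indicator S x *\<^sub>R f x) \<in> borel_measurable N"
    by (simp add: borel_measurable_restrict_space_iff)
  \<comment> \<open>The rule wants a function measurable on all of \<open>N\<close>, but
    \<open>f\<close> is measurable on \<open>S\<close> only. It is therefore applied to the cut-off
    function, and the doubled indicator collapses.\<close>
  have "integrable N (\<lambda>x. indicator S x *\<^sub>R (indicator S x *\<^sub>R f x))"
    using S m B by (intro integrableI_bounded_set_indicator[where B=B]) auto
  moreover have "(\<lambda>x. indicator S x *\<^sub>R (indicator S x *\<^sub>R f x)) = (\<lambda>x. indicator S x *\<^sub>R f x)"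
    by (auto simp: indicator_def)
  ultimately show ?thesis by (simp only: set_integrable_def)
qed

lemma set_integrable_bounded_mult:
  fixes f g :: "'a \<Rightarrow> real"
  assumes S: "S \<in> sets N" "emeasure N S < \<infinity>"
    and f: "f \<in> borel_measurable (restrict_space N S)" "bounded (f ` S)"
    and g: "g \<in> borel_measurable (restrict_space N S)" "bounded (g ` S)"
  shows "set_integrable N S (\<lambda>x. f x * g x)"
proof (rule set_integrable_bounded[OF S])
  obtain B C where "\<And>x. x \<in> S \<Longrightarrow> \<bar>f x\<bar> \<le> B" "\<And>x. x \<in> S \<Longrightarrow> \<bar>g x\<bar> \<le> C"
    using f(2) g(2) unfolding bounded_iff by auto
  \<comment> \<open>That \<open>B\<close> is nonnegative comes from its bound at the point
    \<open>x\<close> itself; for empty \<open>S\<close> nothing would force it.\<close>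
  then have "\<bar>f x * g x\<bar> \<le> B * C" if "x \<in> S" for x
    unfolding abs_mult using that by (intro mult_mono) (auto intro: order_trans[OF abs_ge_zero])
  then show "bounded ((\<lambda>x. f x * g x) ` S)"
    unfolding bounded_iff by auto
qed (use f g in measurable)

text \<open>Fubini twice, each time integrating out the first remaining coordinate on the inside;
  this produces the order dx dy dt.\<close>

lemma set_integral_triple_product:
  fixes g :: "real \<times> real \<times> real \<Rightarrow> real"
  assumes g: "set_integrable lborel (A \<times> B \<times> C) g"
  shows "(LINT z:A \<times> B \<times> C|lborel. g z) =
    (LINT t:C|lborel. LINT y:B|lborel. LINT x:A|lborel. g (x, y, t))"
proof -
  let ?G = "\<lambda>z. indicator (A \<times> B \<times> C) z *\<^sub>R g z"
  have "integrable (lborel \<Otimes>\<^sub>M lborel) ?G"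
    using g by (simp add: set_integrable_def lborel_prod)
  then have G: "integrable (lborel \<Otimes>\<^sub>M lborel) (case_prod (\<lambda>x w. ?G (x, w)))"
    by (simp only: case_prod_beta' prod.collapse)
  let ?H = "\<lambda>w. LINT x|lborel. ?G (x, w)"
  \<comment> \<open>The partial integral is again integrable on the remaining plane, which licenses
    the second use of Fubini.\<close>
  have "integrable lborel ?H" by (rule lborel_pair.integrable_snd[OF G])
  then have "integrable (lborel \<Otimes>\<^sub>M lborel) ?H" by (simp add: lborel_prod)
  then have H: "integrable (lborel \<Otimes>\<^sub>M lborel) (case_prod (\<lambda>y t. ?H (y, t)))"
    by (simp only: case_prod_beta' prod.collapse)
  have "(LINT z:A \<times> B \<times> C|lborel. g z) = (LINT z|(lborel \<Otimes>\<^sub>M lborel). ?G z)"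
    by (simp add: set_lebesgue_integral_def lborel_prod)
  also have "\<dots> = (LINT w|lborel. ?H w)"
    using lborel_pair.integral_snd[OF G] by (simp only: case_prod_beta' prod.collapse)
  also have "\<dots> = (LINT w|(lborel \<Otimes>\<^sub>M lborel). ?H w)"
    by (simp add: lborel_prod)
  also have "\<dots> = (LINT t|lborel. LINT y|lborel. ?H (y, t))"
    using lborel_pair.integral_snd[OF H] by (simp only: case_prod_beta' prod.collapse)
  \<comment> \<open>The indicator of the box splits into three factors, and those of the outer
    variables move across the inner integrals.\<close>
  also have "\<dots> = (LINT t:C|lborel. LINT y:B|lborel. LINT x:A|lborel. g (x, y, t))"
    unfolding set_lebesgue_integral_def
    by (simp add: indicator_times mult_ac flip: integral_mult_right_zero)
  finally show ?thesis .
qed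

section \<open>The compensated process\<close>

context inhomogeneous_poisson_process
begin

text \<open>The axiom gives independence for disjoint sets only, whereas the past is generated by
  counts over overlapping Borel sets. Finitely many such sets are resolved into disjoint atoms, to
  which the axiom applies jointly with \<open>D\<close>; intersection-stable generators carry the
  result to the full sigma-algebra.\<close>

lemma indep_points_sigma_count_points:
  assumes R: "R \<in> sets borel" "R \<subseteq> \<Omega>" and D: "D \<in> sets borel" "D \<subseteq> \<Omega>" and disj: "R \<inter> D = {}"
  shows "indep_set (sets (points_sigma M P R))
           {(\<lambda>\<omega>. count_points D (P \<omega>)) -` K \<inter> space M | K. K \<in> sets (count_space UNIV)}"
proof -
  note [measurable] = random_configuration R(1) D(1)
  \<comment> \<open>A pair in \<open>J\<close> is a set together with the count prescribed for it.
    These events are closed under intersection because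
    \<open>cyl J \<inter> cyl L = cyl (J \<union> L)\<close>.\<close>
  define cyl where "cyl J = {\<omega>\<in>space M. \<forall>j\<in>J. count_points (fst j \<inter> R) (P \<omega>) = snd j}"
    for J :: "('a set \<times> nat) set"
  define C where "C = {cyl J | J. finite J \<and> fst ` J \<subseteq> sets borel}"
  define E where "E = {(\<lambda>\<omega>. count_points D (P \<omega>)) -` K \<inter> space M | K. K \<in> sets (count_space UNIV)}"
  have "indep_set C E"
  proof (rule indep_setI)
    show "C \<subseteq> events"
    proof
      fix a assume "a \<in> C"
      then obtain J where a: "a = cyl J" "finite J" "fst ` J \<subseteq> sets borel" by (auto simp: C_def)
      have "{\<omega>\<in>space M. count_points (fst j \<inter> R) (P \<omega>) = snd j} \<in> events" if "j \<in> J" for j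
      proof -
        from that a have [measurable]: "fst j \<in> sets borel" by auto
        show ?thesis by measurable
      qed
      then have "{\<omega>\<in>space M. \<forall>j\<in>J. count_points (fst j \<inter> R) (P \<omega>) = snd j} \<in> events"
        using a by (intro sets.sets_Collect_finite_All) auto
      then show "a \<in> events" by (simp add: a cyl_def)
    qed
    show "E \<subseteq> events"
      unfolding E_def by (auto intro!: measurable_sets[where A="count_space UNIV"])
  next
    fix a b assume "a \<in> C" "b \<in> E"
    then obtain J K where a: "a = cyl J" "finite J" "fst ` J \<subseteq> sets borel"
      and b: "b = (\<lambda>\<omega>. count_points D (P \<omega>)) -` K \<inter> space M" by (auto simp: C_def E_def)
    \<comment> \<open>Cut \<open>R\<close> into the atoms of the finite algebra generated by the sets in \<open>J\<close>:
      the counts over the atoms determine \<open>a\<close>.\<close>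
    obtain e :: "('a set \<times> nat) set \<Rightarrow> nat" where e: "inj_on e (Pow J)"
      using finite_imp_inj_to_nat_seg[of "Pow J"] a(2) by auto
    define atom where "atom i = {x\<in>R. e {j\<in>J. x \<in> fst j} = i}" for i
    \<comment> \<open>\<open>D\<close> occupies index 0 and the atoms are shifted by one.\<close>
    define G where "G = case_nat D atom"
    have atom_sets: "atom i \<in> sets borel" for i
    proof -
      \<comment> \<open>The points with pattern \<open>S\<close> form a finite intersection of Borel
        sets and complements.\<close>
      define cell where "cell S = {x. \<forall>j\<in>J. x \<in> (if j \<in> S then fst j else - fst j)}" for S
      have cell: "x \<in> cell S \<longleftrightarrow> {j\<in>J. x \<in> fst j} = S" if "S \<subseteq> J" for x S
        using that unfolding cell_def by (auto split: if_splits)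
      have "cell S \<in> sets borel" for S
      proof -
        have "{x\<in>space borel. \<forall>j\<in>J. x \<in> (if j \<in> S then fst j else - fst j)} \<in> sets borel"
          using a by (intro sets.sets_Collect_finite_All) auto
        then show ?thesis by (simp add: cell_def)
      qed
      moreover have "atom i = R \<inter> (\<Union>S\<in>{S\<in>Pow J. e S = i}. cell S)"
        by (auto simp: atom_def cell)
      ultimately show ?thesis using a(2) R(1) by auto
    qed
    have G: "G i \<in> sets borel \<and> G i \<subseteq> \<Omega>" for i
      using atom_sets D R by (auto simp: G_def atom_def split: nat.split)
    have G_disj: "disjoint_family_on G UNIV"
      using disj by (auto simp: disjoint_family_on_def G_def atom_def split: nat.splits)
    define ev where "ev i = {(\<lambda>\<omega>. count_points (G i) (P \<omega>)) -` A \<inter> space M | A. A \<in> sets (count_space UNIV)}" for i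
    have "indep_sets ev UNIV"
      using independent_counts[of UNIV G] G G_disj by (auto simp: indep_vars_def2 ev_def[abs_def])
    \<comment> \<open>The indices are split into two groups, the atoms (\<open>True\<close>) and
      \<open>D\<close> (\<open>False\<close>); disjoint groups of an independent family generate
      independent sigma-algebras.\<close>
    moreover have "(\<Union>j\<in>UNIV. case_bool (range Suc) {0} j) = UNIV"
      by (auto simp: UNIV_bool) (metis not0_implies_Suc rangeI)
    ultimately have "indep_sets (\<lambda>j. sigma_sets (space M) (\<Union>i\<in>case_bool (range Suc) {0} j. ev i)) UNIV"
    proof (intro indep_sets_collect_sigma)
      show "Int_stable (ev i)" for i
        unfolding ev_def by (rule Int_stable_vimage_sets)
    qed (auto simp: disjoint_family_on_def split: bool.splits)
    then have "indep_set (sigma_sets (space M) (\<Union>i. ev (Suc i))) (sigma_sets (space M) (ev 0))"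
      unfolding indep_set_def
      by (rule indep_sets_mono_sets) (auto split: bool.split)
    then show "prob (a \<inter> b) = prob a * prob b"
    proof (rule indep_setD)
      show "b \<in> sigma_sets (space M) (ev 0)"
        by (rule sigma_sets.Basic) (auto simp: b ev_def G_def)
      \<comment> \<open>It remains to place \<open>a\<close> in the sigma-algebra of the atom
        counts: each \<open>fst j \<inter> R\<close> is a finite disjoint union of atoms, so its
        count is a sum of atom counts.\<close>
      define N where "N = sigma (space M) (\<Union>i. ev (Suc i))"
      have [simp]: "space N = space M" "sets N = sigma_sets (space M) (\<Union>i. ev (Suc i))"
        unfolding N_def by (auto simp: ev_def intro!: space_measure_of sets_measure_of)
      have [measurable]: "(\<lambda>\<omega>. count_points (atom i) (P \<omega>)) \<in> measurable N (count_space UNIV)" for i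
        by (rule measurableI) (auto simp: ev_def G_def intro!: sigma_sets.Basic)
      have "(\<lambda>\<omega>. count_points (fst j \<inter> R) (P \<omega>)) \<in> measurable N (count_space UNIV)" if "j \<in> J" for j
      proof -
        let ?I = "e ` {S\<in>Pow J. j \<in> S}"
        have eq: "fst j \<inter> R = (\<Union>i\<in>?I. atom i)"
        proof (intro set_eqI iffI)
          fix x assume "x \<in> (\<Union>i\<in>?I. atom i)"
          then obtain S where S: "S \<subseteq> J" "j \<in> S" "x \<in> R" "e {j\<in>J. x \<in> fst j} = e S"
            by (auto simp: atom_def)
          \<comment> \<open>Injectivity of \<open>e\<close> on the patterns recovers the pattern
            from its number.\<close>
          with inj_onD[OF e S(4)] have "{j\<in>J. x \<in> fst j} = S" by auto
          with S show "x \<in> fst j \<inter> R" by auto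
        next
          fix x assume x: "x \<in> fst j \<inter> R"
          with that have "e {j\<in>J. x \<in> fst j} \<in> ?I" by (intro imageI) auto
          with x show "x \<in> (\<Union>i\<in>?I. atom i)" by (auto simp only: atom_def)
        qed
        have "finite ?I" using a(2) by auto
        moreover have "disjoint_family_on atom ?I" by (auto simp: disjoint_family_on_def atom_def)
        ultimately have "count_points (fst j \<inter> R) X = (\<Sum>i\<in>?I. count_points (atom i) X)" for X
          unfolding eq by (rule count_points_UN)
        then show ?thesis by simp
      qed
      then have "{\<omega>\<in>space N. count_points (fst j \<inter> R) (P \<omega>) = snd j} \<in> sets N" if "j \<in> J" for j
        using measurable_sets[of "\<lambda>\<omega>. count_points (fst j \<inter> R) (P \<omega>)" N "count_space UNIV" "{snd j}"] that
        by (simp add: vimage_def Int_def conj_commute del: \<open>sets N = _\<close>)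
      then have "{\<omega>\<in>space N. \<forall>j\<in>J. count_points (fst j \<inter> R) (P \<omega>) = snd j} \<in> sets N"
        using a(2) by (intro sets.sets_Collect_finite_All)
      then show "a \<in> sigma_sets (space M) (\<Union>i. ev (Suc i))"
        by (simp add: a cyl_def)
    qed
  qed
  moreover have "Int_stable C"
  proof (rule Int_stableI)
    fix a b assume "a \<in> C" "b \<in> C"
    then obtain J L where "a = cyl J" "finite J" "fst ` J \<subseteq> sets borel"
       "b = cyl L" "finite L" "fst ` L \<subseteq> sets borel" by (auto simp: C_def)
    then have "a \<inter> b = cyl (J \<union> L)" "finite (J \<union> L)" "fst ` (J \<union> L) \<subseteq> sets borel"
      by (auto simp: cyl_def)
    then show "a \<inter> b \<in> C" unfolding C_def by blast
  qed
  moreover have "Int_stable E"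
    unfolding E_def by (rule Int_stable_vimage_sets)
  ultimately have "indep_set (sigma_sets (space M) C) (sigma_sets (space M) E)"
    by (rule indep_set_sigma_sets)
  moreover have "sets (points_sigma M P R) \<subseteq> sigma_sets (space M) C"
    unfolding sets_points_sigma
  proof (rule sigma_sets_mono', safe)
    fix B :: "'a set" and k assume "B \<in> sets borel"
    then have "{\<omega> \<in> space M. count_points (B \<inter> R) (P \<omega>) = k} = cyl {(B, k)}" "fst ` {(B, k)} \<subseteq> sets borel"
      by (simp_all add: cyl_def)
    then show "{\<omega> \<in> space M. count_points (B \<inter> R) (P \<omega>) = k} \<in> C"
      unfolding C_def by blast
  qed
  moreover have "E \<subseteq> sigma_sets (space M) E" by auto
  ultimately show ?thesis
    unfolding indep_sets2_eq E_def[symmetric] by (simp add: subset_iff)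
qed

section \<open>Expectations of counts and sums over events of the past\<close>

lemma has_bochner_integral_count_points:
  assumes B: "B \<in> sets borel" "B \<subseteq> \<Omega>"
  shows "has_bochner_integral M (\<lambda>\<omega>. real (count_points B (P \<omega>))) (LINT x:B|lborel. \<phi> x)"
proof -
  note [measurable] = random_configuration B(1)
  have "0 \<le> (LINT x:B|lborel. \<phi> x)"
    using B flux_nonneg unfolding set_lebesgue_integral_def
    by (intro integral_nonneg_AE AE_I2) (auto simp: indicator_def)
  from has_bochner_integral_poisson_law[OF this]
  have "has_bochner_integral (distr M (count_space UNIV) (\<lambda>\<omega>. count_points B (P \<omega>))) real (LINT x:B|lborel. \<phi> x)"
    by (simp add: poisson_counts[OF B])
  then show ?thesis
    by (simp add: has_bochner_integral_iff integrable_distr_eq integral_distr)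
qed

lemma subalgebra_points_sigma:
  assumes "R \<in> sets borel"
  shows "subalgebra M (points_sigma M P R)"
  using sets_points_sigma_subset[OF measurable_restrict_points[OF assms random_configuration] refl]
  by (simp add: subalgebra_def)

text \<open>The indicator of a past event and the count over \<open>B\<close> are independent, so
  the expectation of their product factors.\<close>

lemma has_bochner_integral_indicator_count_points:
  assumes R: "R \<in> sets borel" "R \<subseteq> \<Omega>" and B: "B \<in> sets borel" "B \<subseteq> \<Omega>" and disj: "R \<inter> B = {}"
    and A: "A \<in> sets (points_sigma M P R)"
  shows "has_bochner_integral M (\<lambda>\<omega>. indicator A \<omega> * real (count_points B (P \<omega>)))
           (prob A * (LINT x:B|lborel. \<phi> x))"
proof -
  note [measurable] = random_configuration B(1)
  let ?X = "indicator A :: _ \<Rightarrow> real" and ?Y = "\<lambda>\<omega>. real (count_points B (P \<omega>))"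
  have AM [measurable]: "A \<in> events"
    using A subalgebra_points_sigma[OF R(1)] by (auto simp: subalgebra_def)
  have "indep_var borel ?X borel ?Y"
  proof -
    have X: "?X -` S \<inter> space M \<in> sets (points_sigma M P R)" if "S \<in> sets borel" for S
      using measurable_sets[of ?X "points_sigma M P R" borel S] A that by simp
    let ?E = "{(\<lambda>\<omega>. count_points B (P \<omega>)) -` K \<inter> space M | K. K \<in> sets (count_space UNIV)}"
    have "Int_stable (sets (points_sigma M P R))"
      by (intro Int_stableI sets.Int)
    then have "indep_set (sigma_sets (space M) (sets (points_sigma M P R))) (sigma_sets (space M) ?E)"
      by (intro indep_set_sigma_sets indep_points_sigma_count_points R B disj Int_stable_vimage_sets)
    moreover have "sigma_sets (space M) {?X -` S \<inter> space M |S. S \<in> sets borel} \<subseteq> sigma_sets (space M) (sets (points_sigma M P R))"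
      by (intro sigma_sets_mono' subsetI, elim CollectE exE conjE) (simp only: X)
    \<comment> \<open>Independence is known for the count as a natural number; the embedding
      \<open>real\<close> creates no further events.\<close>
    moreover have "sigma_sets (space M) {?Y -` S \<inter> space M |S. S \<in> sets borel} \<subseteq> sigma_sets (space M) ?E"
    proof (intro sigma_sets_mono' subsetI)
      fix y assume "y \<in> {?Y -` S \<inter> space M |S. S \<in> sets borel}"
      then obtain S :: "real set" where "y = ?Y -` S \<inter> space M"
        by (elim CollectE exE conjE)
      then have "y = (\<lambda>\<omega>. count_points B (P \<omega>)) -` {n. real n \<in> S} \<inter> space M"
        by (simp only: vimage_def mem_Collect_eq)
      moreover have "{n. real n \<in> S} \<in> sets (count_space UNIV)" by simp
      ultimately show "y \<in> ?E" by (intro CollectI exI conjI)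
    qed
    ultimately have "indep_set (sigma_sets (space M) {?X -` S \<inter> space M |S. S \<in> sets borel})
        (sigma_sets (space M) {?Y -` S \<inter> space M |S. S \<in> sets borel})"
      unfolding indep_sets2_eq by (simp only: subset_iff) blast
    moreover have "?X \<in> borel_measurable M" by simp
    moreover have "?Y \<in> borel_measurable M" by measurable
    ultimately show ?thesis
      by (simp only: indep_var_eq)
  qed
  moreover have "integrable M ?X" "(\<integral>\<omega>. ?X \<omega> \<partial>M) = prob A" by (simp_all add: less_top[symmetric])
  moreover note has_bochner_integral_count_points[OF B]
  ultimately show ?thesis
    by (simp add: has_bochner_integral_iff indep_var_lebesgue_integral indep_var_integrable)
qed

text \<open>Both sides pass to the limit by domination: under the expectation by
  \<open>2 * K\<close> times the count over \<open>D\<close>, under the Lebesgue integral by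
  \<open>2 * K\<close> times \<open>\<bar>\<phi>\<bar>\<close> on \<open>D\<close>. The latter is
  integrable since the flux is bounded on a region of finite volume.\<close>

lemma has_bochner_integral_indicator_sum_mset:
  assumes \<Omega>: "\<Omega> \<in> sets borel" "emeasure lborel \<Omega> < \<infinity>"
    and R: "R \<in> sets borel" "R \<subseteq> \<Omega>" and D: "D \<in> sets borel" "D \<subseteq> \<Omega>" and disj: "R \<inter> D = {}"
    and A: "A \<in> sets (points_sigma M P R)"
    and f: "f \<in> borel_measurable borel" "\<And>x. \<bar>f x\<bar> \<le> K"
  shows "has_bochner_integral M (\<lambda>\<omega>. indicator A \<omega> * (\<Sum>x\<in>#restrict_points D (P \<omega>). f x))
           (prob A * (LINT x:D|lborel. f x * \<phi> x))"
proof -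
  note [measurable] = random_configuration D(1) f(1)
  have AM [measurable]: "A \<in> events"
    using A subalgebra_points_sigma[OF R(1)] by (auto simp: subalgebra_def)
  have "set_integrable lborel \<Omega> \<phi>"
    using \<Omega> flux_measurable flux_bounded by (intro set_integrable_bounded)
       (auto simp: measurable_cong_sets[OF sets_restrict_space_cong[OF sets_lborel] refl])
  then have \<phi>: "set_integrable lborel B \<phi>" if "B \<in> sets borel" "B \<subseteq> \<Omega>" for B
    using that by (elim set_integrable_subset) auto
  then have \<phi>D [measurable]: "integrable lborel (\<lambda>x. indicator D x * \<phi> x)"
    using D by (simp add: set_integrable_def)
  have simple: "has_bochner_integral M (\<lambda>\<omega>. indicator A \<omega> * (\<Sum>x\<in>#restrict_points D (P \<omega>). F x))
           (prob A * (LINT x:D|lborel. F x * \<phi> x))"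
    if F: "F \<in> borel_measurable borel" "finite (range F)" for F
  proof -
    \<comment> \<open>The level sets of \<open>F\<close> inside \<open>D\<close> stay disjoint from
      \<open>R\<close>, so the formula for counts applies to each.\<close>
    define B where "B y = F -` {y} \<inter> D" for y
    have B: "B y \<in> sets borel" "B y \<subseteq> \<Omega>" "R \<inter> B y = {}" for y
      using D disj measurable_sets[OF F(1), of "{y}"] by (auto simp: B_def)
    have "has_bochner_integral M
       (\<lambda>\<omega>. \<Sum>y\<in>range F. y * (indicator A \<omega> * real (count_points (B y) (P \<omega>))))
       (\<Sum>y\<in>range F. y * (prob A * (LINT x:B y|lborel. \<phi> x)))"
      by (intro has_bochner_integral_sum has_bochner_integral_mult_right
          has_bochner_integral_indicator_count_points[OF R B A])
    also have "(\<lambda>\<omega>. \<Sum>y\<in>range F. y * (indicator A \<omega> * real (count_points (B y) (P \<omega>))))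
        = (\<lambda>\<omega>. indicator A \<omega> * (\<Sum>x\<in>#restrict_points D (P \<omega>). F x))"
      by (simp add: sum_mset_simple_function[OF F(2)] B_def sum_distrib_left mult_ac)
    also have "(\<Sum>y\<in>range F. y * (prob A * (LINT x:B y|lborel. \<phi> x)))
        = prob A * (\<Sum>y\<in>range F. (LINT x|lborel. y * (indicator (B y) x * \<phi> x)))"
      by (simp add: sum_distrib_left mult_ac set_lebesgue_integral_def)
    also have "(\<Sum>y\<in>range F. (LINT x|lborel. y * (indicator (B y) x * \<phi> x)))
        = (LINT x|lborel. (\<Sum>y\<in>range F. y * (indicator (B y) x * \<phi> x)))"
      using \<phi>[OF B(1,2)]
      by (intro Bochner_Integration.integral_sum[symmetric] integrable_mult_right) (simp add: set_integrable_def)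
    also have "\<dots> = (LINT x:D|lborel. F x * \<phi> x)"
      unfolding set_lebesgue_integral_def
    proof (intro Bochner_Integration.integral_cong refl)
      fix x
      \<comment> \<open>At a fixed \<open>x\<close> only the term \<open>y = F x\<close>
        survives.\<close>
      have "(\<Sum>y\<in>range F. y * (indicator (B y) x * \<phi> x))
          = (\<Sum>y\<in>range F. if F x = y then y * (indicator D x * \<phi> x) else 0)"
        by (intro sum.cong) (auto simp: B_def indicator_def)
      also have "\<dots> = indicator D x *\<^sub>R (F x * \<phi> x)"
        using F(2) by simp
      finally show "(\<Sum>y\<in>range F. y * (indicator (B y) x * \<phi> x)) = indicator D x *\<^sub>R (F x * \<phi> x)" .
    qed
    finally show ?thesis .
  qed
  obtain F where F: "\<And>i. F i \<in> borel_measurable borel" "\<And>i. finite (range (F i))"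
    "\<And>x. (\<lambda>i::nat. F i x) \<longlonglongrightarrow> f x" "\<And>i x. \<bar>F i x\<bar> \<le> 2 * \<bar>f x\<bar>"
    using borel_measurable_imp_simple_limit[OF f(1)] by metis
  note [measurable] = F(1)
  have FK: "\<bar>F i x\<bar> \<le> 2 * K" for i x
    using F(4)[of i x] f(2)[of x] by simp
  let ?S = "\<lambda>(g :: 'a \<Rightarrow> real) \<omega>. indicator A \<omega> * (\<Sum>x\<in>#restrict_points D (P \<omega>). g x)"
  have w: "integrable M (\<lambda>\<omega>. (2 * K) * real (count_points D (P \<omega>)))"
    using has_bochner_integral_count_points[OF D] by (auto simp: has_bochner_integral_iff)
  have bound: "norm (?S (F i) \<omega>) \<le> (2 * K) * real (count_points D (P \<omega>))" for i \<omega>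
  proof -
    have "norm (?S (F i) \<omega>) \<le> \<bar>\<Sum>x\<in>#restrict_points D (P \<omega>). F i x\<bar>"
      by (auto simp: abs_mult indicator_def)
    also have "\<dots> \<le> (2 * K) * real (count_points D (P \<omega>))"
      unfolding count_points_def by (rule abs_sum_mset_le[OF FK])
    finally show ?thesis .
  qed
  have "(\<lambda>i. ?S (F i) \<omega>) \<longlonglongrightarrow> ?S f \<omega>" for \<omega>
    by (intro tendsto_intros tendsto_sum_mset F(3))
  note lim = this
  have meas: "?S g \<in> borel_measurable M" if "g \<in> borel_measurable borel" for g
    using that by measurable
  note dominated = meas[OF f(1)] meas[OF F(1)] w AE_I2[OF lim] AE_I2[OF bound]
  have int: "integrable M (?S f)" and lim1: "(\<lambda>i. integral\<^sup>L M (?S (F i))) \<longlonglongrightarrow> integral\<^sup>L M (?S f)"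
    by (rule integrable_dominated_convergence[OF dominated] integral_dominated_convergence[OF dominated])+
  have "(\<lambda>i. LINT x:D|lborel. F i x * \<phi> x) \<longlonglongrightarrow> (LINT x:D|lborel. f x * \<phi> x)"
    unfolding set_lebesgue_integral_def
  proof (rule integral_dominated_convergence[where w="\<lambda>x. (2 * K) * \<bar>indicator D x * \<phi> x\<bar>"])
    \<comment> \<open>Measurability of \<open>\<phi>\<close> is given on the region only. Attaching
      the indicator to \<open>\<phi>\<close> leaves a product of globally measurable
      functions.\<close>
    have eq: "indicator D x *\<^sub>R (g x * \<phi> x) = g x * (indicator D x * \<phi> x)" for g x by simp
    show "(\<lambda>x. indicator D x *\<^sub>R (f x * \<phi> x)) \<in> borel_measurable lborel"
      unfolding eq by measurable
    show "(\<lambda>x. indicator D x *\<^sub>R (F i x * \<phi> x)) \<in> borel_measurable lborel" for i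
      unfolding eq by measurable
    show "integrable lborel (\<lambda>x. (2 * K) * \<bar>indicator D x * \<phi> x\<bar>)"
      using \<phi>D by (intro integrable_mult_right integrable_abs)
    show "AE x in lborel. (\<lambda>i. indicator D x *\<^sub>R (F i x * \<phi> x)) \<longlonglongrightarrow> indicator D x *\<^sub>R (f x * \<phi> x)"
      by (intro AE_I2 tendsto_intros F(3))
    show "AE x in lborel. norm (indicator D x *\<^sub>R (F i x * \<phi> x)) \<le> (2 * K) * \<bar>indicator D x * \<phi> x\<bar>" for i
      unfolding eq real_norm_def abs_mult[of "F i _"] by (intro AE_I2 mult_right_mono FK) simp
  qed
  then have "(\<lambda>i. prob A * (LINT x:D|lborel. F i x * \<phi> x)) \<longlonglongrightarrow> prob A * (LINT x:D|lborel. f x * \<phi> x)"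
    by (intro tendsto_intros)
  moreover have "prob A * (LINT x:D|lborel. F i x * \<phi> x) = integral\<^sup>L M (?S (F i))" for i
    using simple[OF F(1,2)] by (simp add: has_bochner_integral_iff)
  ultimately have "integral\<^sup>L M (?S f) = prob A * (LINT x:D|lborel. f x * \<phi> x)"
    using lim1 by (auto intro: LIMSEQ_unique)
  with int show ?thesis by (simp add: has_bochner_integral_iff)
qed

text \<open>Stated for any increasing family of regions, so that the sensor and the one-dimensional
  process are both instances.\<close>

lemma compensated_integral_martingale:
  fixes R :: "'t::linorder \<Rightarrow> 'a set"
  assumes \<Omega>: "\<Omega> \<in> sets borel" "emeasure lborel \<Omega> < \<infinity>"
    and R: "\<And>t. t \<in> I \<Longrightarrow> R t \<in> sets borel" "\<And>t. t \<in> I \<Longrightarrow> R t \<subseteq> \<Omega>"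
    and mono: "\<And>s t. s \<in> I \<Longrightarrow> t \<in> I \<Longrightarrow> s \<le> t \<Longrightarrow> R s \<subseteq> R t"
    and p: "p \<in> borel_measurable (restrict_space borel \<Omega>)" "bounded (p ` \<Omega>)"
  shows "is_martingale M (\<lambda>t. points_sigma M P (R t)) I (\<lambda>t. compensated_integral \<phi> P p (R t))"
proof -
  \<comment> \<open>Extension of \<open>p\<close> by zero: globally Borel and bounded, with the same
    sums and integrals over subsets of \<open>\<Omega>\<close>.\<close>
  define f where "f x = indicator \<Omega> x *\<^sub>R p x" for x
  have f [measurable]: "f \<in> borel_measurable borel"
    using p(1) \<Omega>(1) unfolding f_def by (subst (asm) borel_measurable_restrict_space_iff) auto
  obtain K where K: "0 \<le> K" "\<And>x. x \<in> \<Omega> \<Longrightarrow> \<bar>p x\<bar> \<le> K"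
    using p(2) unfolding bounded_pos by (auto intro: less_imp_le)
  then have fK: "\<bar>f x\<bar> \<le> K" for x
    by (simp add: f_def indicator_def)
  let ?F = "\<lambda>t. points_sigma M P (R t)" and ?X = "\<lambda>t. compensated_integral \<phi> P p (R t)"
  have sum_f: "(\<Sum>x\<in>#restrict_points S Y. p x) = (\<Sum>x\<in>#restrict_points S Y. f x)" if "S \<subseteq> \<Omega>" for S Y
    using that by (intro arg_cong[where f=sum_mset] image_mset_cong) (auto simp: f_def restrict_points_def)
  have int_f: "(LINT x:S|lborel. p x * \<phi> x) = (LINT x:S|lborel. f x * \<phi> x)" if "S \<in> sets borel" "S \<subseteq> \<Omega>" for S
    using that by (intro set_lebesgue_integral_cong) (auto simp: f_def)
  have p\<phi>: "set_integrable lborel S (\<lambda>x. p x * \<phi> x)" if "S \<in> sets borel" "S \<subseteq> \<Omega>" for S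
  proof (rule set_integrable_subset)
    show "set_integrable lborel \<Omega> (\<lambda>x. p x * \<phi> x)"
      using \<Omega> p flux_measurable flux_bounded by (intro set_integrable_bounded_mult)
        (auto simp: measurable_cong_sets[OF sets_restrict_space_cong[OF sets_lborel] refl])
  qed (use that in auto)
  have sub: "subalgebra M (?F t)" if "t \<in> I" for t
    using R(1)[OF that] by (rule subalgebra_points_sigma)
  have int_sum: "integrable M (\<lambda>\<omega>. \<Sum>x\<in>#restrict_points S (P \<omega>). p x)" if "S \<in> sets borel" "S \<subseteq> \<Omega>" for S
  proof -
    \<comment> \<open>Integrability is read off from the formula above with empty past region and
      the sure event.\<close>
    have "integrable M (\<lambda>\<omega>. indicator (space M) \<omega> * (\<Sum>x\<in>#restrict_points S (P \<omega>). f x))"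
      using has_bochner_integral_indicator_sum_mset[OF \<Omega>, of "{}" S "space M" f K]
        sets.top[of "points_sigma M P {}"] that f fK
      by (auto simp: has_bochner_integral_iff)
    then show ?thesis
      by (rule Bochner_Integration.integrable_cong[THEN iffD1, rotated 2]) (auto simp: sum_f[OF that(2)])
  qed
  have int_X: "integrable M (?X t)" if "t \<in> I" for t
    unfolding compensated_integral_def by (intro Bochner_Integration.integrable_diff int_sum R that) simp
  have adapted: "?X t \<in> borel_measurable (?F t)" if "t \<in> I" for t
    unfolding compensated_integral_def sum_f[OF R(2)[OF that]]
    by (intro borel_measurable_diff borel_measurable_const borel_measurable_sum_mset f measurable_points_sigma)
  have cond: "AE \<omega> in M. real_cond_exp M (?F s) (?X t) \<omega> = ?X s \<omega>"
    if st: "s \<in> I" "t \<in> I" "s \<le> t" for s t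
  proof -
    interpret finite_measure_subalgebra M "?F s"
      by unfold_locales (rule sub[OF st(1)])
    define D where "D = R t - R s"
    have D: "D \<in> sets borel" "D \<subseteq> \<Omega>" "R s \<inter> D = {}" and Rt: "R t = R s \<union> D"
      using R[OF st(1)] R[OF st(2)] mono[OF st] by (auto simp: D_def)
    let ?Y = "\<lambda>\<omega>. (\<Sum>x\<in>#restrict_points D (P \<omega>). p x) - (LINT x:D|lborel. p x * \<phi> x)"
    have incr: "?X t \<omega> = ?X s \<omega> + ?Y \<omega>" for \<omega>
      using D R[OF st(1)] unfolding compensated_integral_def Rt
      by (simp add: restrict_points_Un set_integral_Un p\<phi>)
    have int_Y: "integrable M ?Y"
      by (intro Bochner_Integration.integrable_diff int_sum D) simp
    show ?thesis
    \<comment> \<open>The conditional expectation is characterised by equal integrals over every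
      event \<open>A\<close> of the past, so the increment must integrate to zero over
      \<open>A\<close>.\<close>
    proof (rule real_cond_exp_charact)
      fix A assume A: "A \<in> sets (?F s)"
      then have AM [measurable]: "A \<in> events"
        using sub[OF st(1)] by (auto simp: subalgebra_def)
      have "has_bochner_integral M (\<lambda>\<omega>. indicator A \<omega> * (\<Sum>x\<in>#restrict_points D (P \<omega>). p x))
          (prob A * (LINT x:D|lborel. p x * \<phi> x))"
        unfolding sum_f[OF D(2)] int_f[OF D(1,2)]
        by (rule has_bochner_integral_indicator_sum_mset[OF \<Omega> R[OF st(1)] D A f fK])
      \<comment> \<open>The compensator is deterministic, so over \<open>A\<close> it integrates to
        exactly the value found for the sum.\<close>
      moreover have "has_bochner_integral M (\<lambda>\<omega>. indicator A \<omega> * (LINT x:D|lborel. p x * \<phi> x))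
          (prob A * (LINT x:D|lborel. p x * \<phi> x))"
        by (auto simp: has_bochner_integral_iff less_top[symmetric])
      ultimately have "has_bochner_integral M (\<lambda>\<omega>. indicator A \<omega> * ?Y \<omega>) 0"
        unfolding right_diff_distrib by (metis (no_types) has_bochner_integral_diff diff_self)
      then have "(LINT \<omega>:A|M. ?Y \<omega>) = 0"
        by (simp add: has_bochner_integral_iff set_lebesgue_integral_def)
      moreover have "set_integrable M A (?X s)" "set_integrable M A ?Y"
        unfolding set_integrable_def by (intro integrable_mult_indicator AM int_X st int_Y)+
      ultimately show "(LINT \<omega>:A|M. ?X t \<omega>) = (LINT \<omega>:A|M. ?X s \<omega>)"
        unfolding incr by (simp add: set_integral_add)
    qed (use int_X adapted st in auto)
  qed
  have "sets (?F s) \<subseteq> sets (?F t)" if st: "s \<in> I" "t \<in> I" "s \<le> t" for s t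
  proof (rule sets_points_sigma_subset)
    \<comment> \<open>Since \<open>R s \<subseteq> R t\<close>, restriction to \<open>R s\<close>
      factors through restriction to \<open>R t\<close>.\<close>
    have "(\<lambda>\<omega>. restrict_points (R s) (restrict_points (R t) (P \<omega>))) \<in> measurable (?F t) config_space"
      by (intro measurable_restrict_points R st measurable_points_sigma)
    then show "(\<lambda>\<omega>. restrict_points (R s) (P \<omega>)) \<in> measurable (?F t) config_space"
      using mono[OF st] by (simp add: restrict_points_restrict Int_absorb2)
  qed simp
  with sub adapted int_X cond show ?thesis
    by (simp add: is_martingale_def)
qed

text \<open>A pathwise identity: all points lie in \<open>\<Omega>\<close>, so restricting to it
  changes nothing and the compensator cancels.\<close>

lemma sum_mset_eq_compensated_integral:
  assumes "\<omega> \<in> space M"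
  shows "(\<Sum>x\<in>#P \<omega>. p x) = (LINT x:\<Omega>|lborel. p x * \<phi> x) + compensated_integral \<phi> P p \<Omega> \<omega>"
proof -
  have "restrict_points \<Omega> (P \<omega>) = P \<omega>"
    using points_in_region[OF assms] by (auto simp: restrict_points_def filter_mset_eq_conv)
  then show ?thesis by (simp add: compensated_integral_def)
qed

end

section \<open>The sensor box and the time interval\<close>

lemma sensor_region_measurable:
  "sensor_region w h t \<in> sets borel" "emeasure lborel (sensor_region w h t) < \<infinity>"
proof -
  have c: "compact (sensor_region w h t)"
    unfolding sensor_region_def by (intro compact_Times compact_Icc)
  then show "sensor_region w h t \<in> sets borel"
    by (intro borel_closed compact_imp_closed)
  from c show "emeasure lborel (sensor_region w h t) < \<infinity>"
    by (intro emeasure_bounded_finite compact_imp_bounded)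
qed

theorem mainTheorem1:
  fixes M :: "'w measure" and T :: real
  assumes "0 < T"
  shows
    "(\<forall>(w::real) (h::real) (\<phi> :: real \<times> real \<times> real \<Rightarrow> real)
        (P :: 'w \<Rightarrow> (real \<times> real \<times> real) multiset) (p :: real \<times> real \<times> real \<Rightarrow> real).
        0 < w \<longrightarrow> 0 < h \<longrightarrow>
        inhomogeneous_poisson_process M (sensor_region w h T) \<phi> P \<longrightarrow>
        p \<in> borel_measurable (restrict_space borel (sensor_region w h T)) \<longrightarrow>
        bounded (p ` sensor_region w h T) \<longrightarrow>
          (\<forall>\<omega>\<in>space M. (\<Sum>z\<in>#P \<omega>. p z) =
             (LINT t:{0..T}|lborel. LINT y:{0..h}|lborel. LINT x:{0..w}|lborel.
                p (x, y, t) * \<phi> (x, y, t))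
             + compensated_integral \<phi> P p (sensor_region w h T) \<omega>) \<and>
          is_martingale M (\<lambda>t. points_sigma M P (sensor_region w h t)) {0..T}
            (\<lambda>t. compensated_integral \<phi> P p (sensor_region w h t)))
     \<and>
     (\<forall>(\<phi> :: real \<Rightarrow> real) (P :: 'w \<Rightarrow> real multiset) (p :: real \<Rightarrow> real).
        inhomogeneous_poisson_process M {0..T} \<phi> P \<longrightarrow>
        p \<in> borel_measurable (restrict_space borel {0..T}) \<longrightarrow>
        bounded (p ` {0..T}) \<longrightarrow>
          (\<forall>\<omega>\<in>space M. (\<Sum>t\<in>#P \<omega>. p t) =
             (LINT t:{0..T}|lborel. p t * \<phi> t)
             + compensated_integral \<phi> P p {0..T} \<omega>) \<and>
          is_martingale M (\<lambda>t. points_sigma M P {0..t}) {0..T}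
            (\<lambda>t. compensated_integral \<phi> P p {0..t}))"
proof (intro conjI allI impI ballI)
  fix w h :: real and \<phi> p :: "real \<times> real \<times> real \<Rightarrow> real" and P :: "'w \<Rightarrow> (real \<times> real \<times> real) multiset"
  assume "inhomogeneous_poisson_process M (sensor_region w h T) \<phi> P"
    and p: "p \<in> borel_measurable (restrict_space borel (sensor_region w h T))"
      "bounded (p ` sensor_region w h T)"
  then interpret inhomogeneous_poisson_process M "sensor_region w h T" \<phi> P by simp
  show "is_martingale M (\<lambda>t. points_sigma M P (sensor_region w h t)) {0..T}
      (\<lambda>t. compensated_integral \<phi> P p (sensor_region w h t))"
    by (rule compensated_integral_martingale[OF sensor_region_measurable sensor_region_measurable(1) _ _ p])
       (auto simp: sensor_region_def)
  fix \<omega> assume "\<omega> \<in> space M"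
  \<comment> \<open>Integrability over the box justifies rewriting the integral as an iterated
    one.\<close>
  have "set_integrable lborel (sensor_region w h T) (\<lambda>z. p z * \<phi> z)"
    using p flux_measurable flux_bounded sensor_region_measurable
    by (intro set_integrable_bounded_mult)
       (auto simp: measurable_cong_sets[OF sets_restrict_space_cong[OF sets_lborel] refl])
  then have "(LINT z:sensor_region w h T|lborel. p z * \<phi> z) =
      (LINT t:{0..T}|lborel. LINT y:{0..h}|lborel. LINT x:{0..w}|lborel. p (x, y, t) * \<phi> (x, y, t))"
    unfolding sensor_region_def by (rule set_integral_triple_product)
  with sum_mset_eq_compensated_integral[OF \<open>\<omega> \<in> space M\<close>, of p]
  show "(\<Sum>z\<in>#P \<omega>. p z) =
      (LINT t:{0..T}|lborel. LINT y:{0..h}|lborel. LINT x:{0..w}|lborel. p (x, y, t) * \<phi> (x, y, t))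
      + compensated_integral \<phi> P p (sensor_region w h T) \<omega>" by simp
next
  fix \<phi> p :: "real \<Rightarrow> real" and P :: "'w \<Rightarrow> real multiset"
  assume "inhomogeneous_poisson_process M {0..T} \<phi> P"
    and p: "p \<in> borel_measurable (restrict_space borel {0..T})" "bounded (p ` {0..T})"
  then interpret inhomogeneous_poisson_process M "{0..T}" \<phi> P by simp
  show "is_martingale M (\<lambda>t. points_sigma M P {0..t}) {0..T} (\<lambda>t. compensated_integral \<phi> P p {0..t})"
    by (rule compensated_integral_martingale[OF _ _ _ _ _ p]) (auto simp: emeasure_lborel_Icc_eq)
  show "(\<Sum>t\<in>#P \<omega>. p t) = (LINT t:{0..T}|lborel. p t * \<phi> t) + compensated_integral \<phi> P p {0..T} \<omega>"
    if "\<omega> \<in> space M" for \<omega>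
    using that by (rule sum_mset_eq_compensated_integral)
qed

end
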